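(* Let $(X,X_+,\mathcal{K},f)$ be an abstract state space and let $\{T_n\}_{n\ge1}$ be a sequence of Markov operators on $X$, the generating sequence of the NDMC $\{T^{k,n}\}$. Let $\{P_n\}_{n\ge1}$ be a sequence of projections of $X$ such that (i) $T_nP_n=P_nT_n=P_n$ for all $n\in\mathbb{N}$; (ii) $\{P_n\}$ is left decreasing; (iii) $\sum_{n=k}^\infty\|P_{n+1}-P_n\|\to 0$ as $k\to\infty$. Let $P$ denote the norm limit of $\{P_n\}$ (which exists by (iii)). If $\{T^{k,n}\}$ is weakly $P$-ergodic, then it is uniformly $P$-ergodic.
   Context: Abstract state space: $X$ is a real ordered vector space with generating cone $X_+=\{x\in X: x\ge 0\}$ (i.e. $X=X_+-X_+$), $f$ is a strictly positive linear functional on $X$ ($f(x)>0$ for $x>0$), and $\mathcal{K}=\{x\in X_+: f(x)=1\}$. With $U$ the convex hull of $\mathcal{K}\cup(-\mathcal{K})$, put $\|x\|=\inf\{\lambda\in\mathbb{R}_+: x\in\lambda U\}$. $(X,X_+,\mathcal{K},f)$ is an abstract state space if $\|\cdot\|$ is a norm, $X$ is complete for it, and $X_+$ is closed. $X$ always carries this norm, and norms of operators are the induced operator norms. Markov operator: a linear $T:X\to X$ that is positive and satisfies $T(\mathcal{K})\subset\mathcal{K}$ (then $\|T\|=1$). Projection: a bounded linear $P:X\to X$ with $P^2=P$. $\mathbb{N}=\{1,2,\dots\}$. The nonhomogeneous discrete Markov chain (NDMC) generated by $\{T_n\}_{n\ge1}$ is the family $T^{k,n}=T_nT_{n-1}\cdots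 T_{k+1}$, $0\le k<n$. A sequence of projections $\{P_n\}$ is left decreasing if $P_{n+1}P_n=P_{n+1}$ for all $n\in\mathbb{N}$. Generalized Dobrushin coefficient: for a projection $P\neq I$, $N_P=\{x\in X: Px=0\}$ and $\delta_P(T)=\sup_{x\in N_P,\,x\ne0}\|Tx\|/\|x\|$ for bounded linear $T$; by convention $\delta_I(T)=1$. $\{T^{k,n}\}$ is uniformly $P$-ergodic if $\lim_{n\to\infty}\|T^{m,n}-P\|=0$ for every $m\ge0$, and weakly $P$-ergodic if $\lim_{n\to\infty}\delta_P(T^{m,n})=0$ for every $m\ge0$. *)

theory Defs
  imports "HOL-Analysis.Analysis"
begin

text \<open>
  The vector space order and a complete norm come from the type classes;
  \<open>abstract_state_space\<close> requires that this norm is the gauge of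
  the convex hull of \<open>K \<union> - K\<close>, with \<open>K = state_base f\<close>.
\<close>

definition state_base :: "('a::ordered_real_vector \<Rightarrow> real) \<Rightarrow> 'a set"
  where "state_base f = {x. 0 \<le> x \<and> f x = 1}"

definition base_unit :: "('a::ordered_real_vector \<Rightarrow> real) \<Rightarrow> 'a set"
  where "base_unit f = convex hull (state_base f \<union> uminus ` state_base f)"

definition abstract_state_space :: "('a::{ordered_real_vector,banach} \<Rightarrow> real) \<Rightarrow> bool"
  where "abstract_state_space f \<longleftrightarrow>
    linear f \<and>
    (\<forall>x>0. f x > 0) \<and>
    (\<forall>x::'a. \<exists>y z. 0 \<le> y \<and> 0 \<le> z \<and> x = y - z) \<and>
    (\<forall>x. norm x = Inf {l::real. 0 \<le> l \<and> x \<in> (\<lambda>u. l *\<^sub>R u) ` base_unit f}) \<and>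
    closed {x::'a. 0 \<le> x}"

definition markov_operator ::
    "('a::ordered_real_vector \<Rightarrow> real) \<Rightarrow> ('a \<Rightarrow> 'a) \<Rightarrow> bool"
  where "markov_operator f T \<longleftrightarrow>
    linear T \<and> (\<forall>x\<ge>0. T x \<ge> 0) \<and> T ` state_base f \<subseteq> state_base f"

definition projection :: "('a::real_normed_vector \<Rightarrow> 'a) \<Rightarrow> bool"
  where "projection P \<longleftrightarrow> bounded_linear P \<and> P \<circ> P = P"

text \<open>
  \<open>ndmc T k n\<close> is \<open>T n \<circ> \<dots> \<circ> T (k + 1)\<close> for \<open>k < n\<close>, and the
  identity for \<open>n \<le> k\<close>.  Operator sequences are indexed by \<open>{1, 2, \<dots>}\<close>;
  their entry at index 0 is unconstrained and has no influence on limits or summability.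
\<close>

primrec ndmc :: "(nat \<Rightarrow> 'a \<Rightarrow> 'a) \<Rightarrow> nat \<Rightarrow> nat \<Rightarrow> 'a \<Rightarrow> 'a" where
  "ndmc T k 0 = id"
| "ndmc T k (Suc n) = (if k < Suc n then T (Suc n) \<circ> ndmc T k n else id)"

definition left_decreasing :: "(nat \<Rightarrow> 'a \<Rightarrow> 'a) \<Rightarrow> bool"
  where "left_decreasing P \<longleftrightarrow> (\<forall>n\<ge>1. P (Suc n) \<circ> P n = P (Suc n))"

definition dobrushin ::
    "('a::real_normed_vector \<Rightarrow> 'a) \<Rightarrow> ('a \<Rightarrow> 'a) \<Rightarrow> real"
  where "dobrushin P T =
    (if P = id then 1 else (SUP x\<in>{x. P x = 0 \<and> x \<noteq> 0}. norm (T x) / norm x))"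

definition operator_norm_limit ::
    "(nat \<Rightarrow> 'a::real_normed_vector \<Rightarrow> 'a) \<Rightarrow> ('a \<Rightarrow> 'a) \<Rightarrow> bool"
  where "operator_norm_limit S P \<longleftrightarrow>
    bounded_linear P \<and> (\<lambda>n. onorm (\<lambda>x. S n x - P x)) \<longlonglongrightarrow> 0"

definition uniformly_ergodic ::
    "(nat \<Rightarrow> 'a::real_normed_vector \<Rightarrow> 'a) \<Rightarrow> ('a \<Rightarrow> 'a) \<Rightarrow> bool"
  where "uniformly_ergodic T P \<longleftrightarrow>
    (\<forall>m. (\<lambda>n. onorm (\<lambda>x. ndmc T m n x - P x)) \<longlonglongrightarrow> 0)"

definition weakly_ergodic ::
    "(nat \<Rightarrow> 'a::real_normed_vector \<Rightarrow> 'a) \<Rightarrow> ('a \<Rightarrow> 'a) \<Rightarrow> bool"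
  where "weakly_ergodic T P \<longleftrightarrow>
    (\<forall>m. (\<lambda>n. dobrushin P (ndmc T m n)) \<longlonglongrightarrow> 0)"

end

theory Submission
  imports Defs
begin

text \<open>
  Everything rests on two facts about the limit \<open>P\<close> of the projections.

  The first is that \<open>P\<close> absorbs the chain on its right.  Left decrease propagates to
  \<open>P\<^sub>l P\<^sub>n = P\<^sub>l\<close> for all \<open>l \<ge> n\<close>, and \<open>l \<rightarrow> \<infinity>\<close> gives \<open>P P\<^sub>n = P\<close>.  Hence
  \<open>P T\<^sub>n = P P\<^sub>n T\<^sub>n = P P\<^sub>n = P\<close>, and \<open>P\<close> is itself a projection.

  The second is that a late piece of the chain almost fixes the range of \<open>P\<close>, uniformly in the
  length of the piece.  Each \<open>T\<^sub>n\<close> fixes the range of \<open>P\<^sub>n\<close>, so the error made when the index of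
  the projection advances by one is \<open>\<parallel>P\<^sub>n\<^sub>+\<^sub>1 - P\<^sub>n\<parallel>\<close>; as Markov operators are contractions,
  these errors only add up, and \<open>\<parallel>T\<^sup>k\<^sup>,\<^sup>n P - P\<parallel>\<close> is bounded by a tail of a convergent series and
  the distances of \<open>P\<^sub>k\<close> and \<open>P\<^sub>n\<close> from \<open>P\<close> (\<open>ndmc_almost_fixes_limit\<close>).

  Splitting the chain at a time \<open>k\<close> between \<open>m\<close> and \<open>n\<close>, and using \<open>P T\<^sup>m\<^sup>,\<^sup>k = P\<close>,
  \[ T^{m,n} - P = T^{k,n} (I - P) T^{m,k} + (T^{k,n} P - P). \]
  The second summand is small once \<open>k\<close> is large, whatever \<open>n\<close> is.  With \<open>k\<close> fixed, the first
  summand has norm at most \<open>\<delta>\<^sub>P(T\<^sup>k\<^sup>,\<^sup>n) \<parallel>I - P\<parallel>\<close>, because \<open>I - P\<close> maps into the kernel of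
  \<open>P\<close>; weak ergodicity makes it tend to zero as \<open>n \<rightarrow> \<infinity>\<close>.
\<close>

section \<open>Markov operators are contractions\<close>

text \<open>
  The infimum defining the norm is taken over a nonempty set, so that enlarging the set does
  decrease it (the infimum of the empty set of reals carries no information).  In the zero
  space \<open>base_unit f\<close> is empty, whence the assumption \<open>x \<noteq> 0\<close>.
\<close>
lemma gauge_set_nonempty:
  fixes f :: "'a::{ordered_real_vector,banach} \<Rightarrow> real"
  assumes ass: "abstract_state_space f" and "x \<noteq> 0"
  shows "\<exists>l\<ge>0. x \<in> (\<lambda>u. l *\<^sub>R u) ` base_unit f"
proof -
  have lin: "linear f" and pos: "\<And>x. x > 0 \<Longrightarrow> f x > 0"
    and generating: "\<forall>x::'a. \<exists>y z. 0 \<le> y \<and> 0 \<le> z \<and> x = y - z"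
    using ass by (simp_all add: abstract_state_space_def)
  obtain y z where yz: "0 \<le> y" "0 \<le> z" "x = y - z"
    using generating by metis
  have conv: "convex (base_unit f)"
    by (simp add: base_unit_def)
  have normalize: "y /\<^sub>R f y \<in> state_base f" if "y > 0" for y
    using pos[OF that] that lin
    by (auto simp: state_base_def linear_scale scaleR_nonneg_nonneg)
  have in_base: "u \<in> base_unit f" "- u \<in> base_unit f" if "u \<in> state_base f" for u
    using that by (auto simp: base_unit_def intro!: hull_inc)
  consider "y > 0" "z > 0" | "y > 0" "z = 0" | "y = 0" "z > 0"
    using yz \<open>x \<noteq> 0\<close> by fastforce
  then show ?thesis
  proof cases
    case 1
    define l where "l = f y + f z"
    have fy: "f y > 0" and fz: "f z > 0" and "l > 0"
      using pos 1 by (auto simp: l_def add_pos_pos)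
    have "(f y / l) *\<^sub>R (y /\<^sub>R f y) + (f z / l) *\<^sub>R (- (z /\<^sub>R f z)) \<in> base_unit f"
      using fy fz \<open>l > 0\<close> in_base normalize 1
      by (intro convexD[OF conv]) (auto simp: l_def add_divide_distrib[symmetric])
    moreover have "x = l *\<^sub>R ((f y / l) *\<^sub>R (y /\<^sub>R f y) + (f z / l) *\<^sub>R (- (z /\<^sub>R f z)))"
      using fy fz \<open>l > 0\<close> yz(3) by (simp add: algebra_simps)
    ultimately show ?thesis
      using \<open>l > 0\<close> by (intro exI[of _ l]) auto
  next
    case 2
    with yz(3) pos[of y] show ?thesis
      by (intro exI[of _ "f y"] conjI image_eqI[OF _ in_base(1)[OF normalize]]) auto
  next
    case 3
    with yz(3) pos[of z] show ?thesis
      by (intro exI[of _ "f z"] conjI image_eqI[OF _ in_base(2)[OF normalize]]) auto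
  qed
qed

text \<open>
  A Markov operator maps the base, hence the unit body \<open>base_unit f\<close>, into itself; every
  scalar admissible in the gauge of \<open>x\<close> is therefore admissible in the gauge of \<open>T x\<close>.
\<close>
lemma markov_operator_norm_le:
  fixes f :: "'a::{ordered_real_vector,banach} \<Rightarrow> real"
  assumes ass: "abstract_state_space f" and M: "markov_operator f T"
  shows "norm (T x) \<le> norm x"
proof (cases "x = 0")
  case True
  with M show ?thesis
    by (simp add: markov_operator_def linear_0)
next
  case False
  let ?G = "\<lambda>x. {l::real. 0 \<le> l \<and> x \<in> (\<lambda>u. l *\<^sub>R u) ` base_unit f}"
  have lin: "linear T" and base: "T ` state_base f \<subseteq> state_base f"
    using M by (auto simp: markov_operator_def)
  have norm_eq: "norm y = Inf (?G y)" for y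
    using ass by (simp add: abstract_state_space_def)
  have "T ` base_unit f = convex hull (T ` (state_base f \<union> uminus ` state_base f))"
    unfolding base_unit_def by (rule convex_hull_linear_image[OF lin])
  also have "\<dots> \<subseteq> base_unit f"
    unfolding base_unit_def using base
    by (intro hull_mono) (auto simp: linear_neg[OF lin])
  finally have U: "T ` base_unit f \<subseteq> base_unit f" .
  have "?G x \<subseteq> ?G (T x)"
  proof clarify
    fix l u
    assume "u \<in> base_unit f"
    then have "T u \<in> base_unit f"
      using U by blast
    then show "T (l *\<^sub>R u) \<in> (\<lambda>u. l *\<^sub>R u) ` base_unit f"
      unfolding linear_scale[OF lin] by (rule imageI)
  qed
  then have "Inf (?G (T x)) \<le> Inf (?G x)"
    using gauge_set_nonempty[OF ass False]
    by (intro cInf_superset_mono) (auto intro!: bdd_belowI[of _ 0])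
  then show ?thesis
    by (simp only: norm_eq)
qed

section \<open>Norm limits of operators\<close>

lemma operator_norm_limit_exists:
  fixes S :: "nat \<Rightarrow> 'a::banach \<Rightarrow> 'a"
  assumes bl: "\<And>n. n \<ge> 1 \<Longrightarrow> bounded_linear (S n)"
    and sum: "summable (\<lambda>n. onorm (\<lambda>x. S (Suc n) x - S n x))"
  shows "\<exists>P. operator_norm_limit S P"
proof -
  \<comment> \<open>The shift by one discards \<open>S 0\<close>, which need not be bounded or linear.\<close>
  define B where "B n = Blinfun (S (Suc n))" for n
  have B: "blinfun_apply (B n) = S (Suc n)" for n
    using bl by (simp add: B_def bounded_linear_Blinfun_apply)
  have "summable (\<lambda>n. norm (B (Suc n) - B n))"
    using sum summable_Suc_iff[of "\<lambda>n. onorm (\<lambda>x. S (Suc n) x - S n x)"]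
    by (simp add: norm_blinfun.rep_eq minus_blinfun.rep_eq B)
  then have "summable (\<lambda>n. B (Suc n) - B n)"
    by (rule summable_norm_cancel)
  then have "(\<lambda>n. \<Sum>i<n. B (Suc i) - B i) \<longlonglongrightarrow> (\<Sum>n. B (Suc n) - B n)"
    by (rule summable_LIMSEQ)
  then have "(\<lambda>n. B n - B 0) \<longlonglongrightarrow> (\<Sum>n. B (Suc n) - B n)"
    by (simp only: sum_lessThan_telescope)
  then have "(\<lambda>n. B n - B 0 + B 0) \<longlonglongrightarrow> (\<Sum>n. B (Suc n) - B n) + B 0"
    by (intro tendsto_add tendsto_const)
  then obtain L where "B \<longlonglongrightarrow> L"
    by auto
  then have "(\<lambda>n. norm (B n - L)) \<longlonglongrightarrow> 0"
    by (intro tendsto_norm_zero) (simp add: LIM_zero)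
  then have "(\<lambda>n. onorm (\<lambda>x. S (Suc n) x - L x)) \<longlonglongrightarrow> 0"
    by (simp add: norm_blinfun.rep_eq minus_blinfun.rep_eq B)
  then have "(\<lambda>n. onorm (\<lambda>x. S n x - L x)) \<longlonglongrightarrow> 0"
    by (rule LIMSEQ_imp_Suc)
  then show ?thesis
    unfolding operator_norm_limit_def
    using blinfun.bounded_linear_right by blast
qed

lemma operator_norm_limit_pointwise:
  assumes lim: "operator_norm_limit S P" and bl: "\<And>n. n \<ge> 1 \<Longrightarrow> bounded_linear (S n)"
  shows "(\<lambda>n. S n x) \<longlonglongrightarrow> P x"
proof -
  have P: "bounded_linear P" and on: "(\<lambda>n. onorm (\<lambda>x. S n x - P x)) \<longlonglongrightarrow> 0"
    using lim by (auto simp: operator_norm_limit_def)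
  have "\<forall>\<^sub>F n in sequentially. norm (S n x - P x) \<le> onorm (\<lambda>x. S n x - P x) * norm x"
    using eventually_ge_at_top[of 1]
    by eventually_elim (intro onorm bounded_linear_sub bl P)
  moreover have "(\<lambda>n. onorm (\<lambda>x. S n x - P x) * norm x) \<longlonglongrightarrow> 0"
    using tendsto_mult_left_zero[OF on] .
  ultimately have "(\<lambda>n. S n x - P x) \<longlonglongrightarrow> 0"
    by (rule Lim_null_comparison)
  then show ?thesis
    by (simp add: LIM_zero_iff)
qed

section \<open>The limit projection absorbs the chain\<close>

lemma left_decreasing_absorb:
  assumes "left_decreasing Ps" "1 \<le> n" "Ps n \<circ> Ps n = Ps n" "n \<le> l"
  shows "Ps l (Ps n x) = Ps l x"
  using assms(4)
proof (induction l rule: dec_induct)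
  case base
  show ?case
    using assms(3) by (metis comp_apply)
next
  case (step l)
  then have "Ps (Suc l) (Ps l y) = Ps (Suc l) y" for y
    using assms(1,2) unfolding left_decreasing_def by (metis comp_apply le_trans)
  then show ?case
    using step.IH by metis
qed

lemma limit_absorbs_projection:
  assumes lim: "operator_norm_limit Ps P"
    and proj: "\<And>n. n \<ge> 1 \<Longrightarrow> projection (Ps n)"
    and "left_decreasing Ps" "1 \<le> n"
  shows "P (Ps n x) = P x"
proof -
  have pointwise: "(\<lambda>n. Ps n y) \<longlonglongrightarrow> P y" for y
    using lim proj by (intro operator_norm_limit_pointwise) (auto simp: projection_def)
  have "\<forall>\<^sub>F l in sequentially. Ps l (Ps n x) = Ps l x"
    using eventually_ge_at_top[of n]
    by eventually_elim (use assms in \<open>auto simp: projection_def intro: left_decreasing_absorb\<close>)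
  then have "(\<lambda>l. Ps l x) \<longlonglongrightarrow> P (Ps n x)"
    using pointwise[of "Ps n x"] by (simp cong: tendsto_cong)
  then show ?thesis
    using pointwise LIMSEQ_unique by blast
qed

lemma limit_idempotent:
  assumes lim: "operator_norm_limit Ps P"
    and proj: "\<And>n. n \<ge> 1 \<Longrightarrow> projection (Ps n)"
    and "left_decreasing Ps"
  shows "P (P x) = P x"
proof -
  have "(\<lambda>n. Ps n x) \<longlonglongrightarrow> P x"
    using lim proj by (intro operator_norm_limit_pointwise) (auto simp: projection_def)
  then have "(\<lambda>n. P (Ps n x)) \<longlonglongrightarrow> P (P x)"
    using lim by (auto simp: operator_norm_limit_def intro: bounded_linear.tendsto)
  moreover have "\<forall>\<^sub>F n in sequentially. P (Ps n x) = P x"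
    using eventually_ge_at_top[of 1]
    by eventually_elim (use assms in \<open>auto intro: limit_absorbs_projection\<close>)
  ultimately have "(\<lambda>n. P x) \<longlonglongrightarrow> P (P x)"
    by (simp cong: tendsto_cong)
  then show ?thesis
    by (simp add: LIMSEQ_const_iff)
qed

lemma ndmc_absorbed:
  assumes "\<And>n x. n \<ge> 1 \<Longrightarrow> P (T n x) = P x"
  shows "P (ndmc T k n x) = P x"
  by (induction n) (auto simp: assms)

section \<open>Chains of contractions\<close>

lemma ndmc_self [simp]: "ndmc T k k = id"
  by (cases k) auto

lemma ndmc_split:
  assumes "m \<le> k" "k \<le> n"
  shows "ndmc T m n x = ndmc T k n (ndmc T m k x)"
  using assms(2,1) by (induction n rule: dec_induct) auto

lemma ndmc_bounded_linear:
  assumes "\<And>n. n \<ge> 1 \<Longrightarrow> bounded_linear (T n)"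
  shows "bounded_linear (ndmc T k n)"
proof (induction n)
  case 0
  show ?case
    using bounded_linear_ident by (simp add: id_def)
next
  case (Suc n)
  have "bounded_linear (\<lambda>x. T (Suc n) (ndmc T k n x))"
    by (rule bounded_linear_compose[OF assms Suc]) simp
  then show ?case
    using bounded_linear_ident by (simp add: id_def o_def)
qed

lemma ndmc_norm_le:
  assumes contr: "\<And>n x. n \<ge> 1 \<Longrightarrow> norm (T n x) \<le> norm x"
  shows "norm (ndmc T k n x) \<le> norm x"
proof (induction n)
  case (Suc n)
  then show ?case
    using order_trans[OF contr[of "Suc n" "ndmc T k n x"] Suc] by simp
qed simp

text \<open>
  The supremum in \<open>dobrushin\<close> is over a set of reals, so that it bounds its members only if
  the set is bounded above; for a contraction \<open>1\<close> is a bound.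
\<close>
lemma norm_le_dobrushin:
  assumes "\<And>x. norm (S x) \<le> norm x" "P \<noteq> id" "P x = 0"
  shows "norm (S x) \<le> dobrushin P S * norm x"
proof (cases "x = 0")
  case True
  with assms(1)[of 0] show ?thesis by simp
next
  case False
  have "bdd_above ((\<lambda>x. norm (S x) / norm x) ` {x. P x = 0 \<and> x \<noteq> 0})"
    using assms(1) by (auto intro!: bdd_aboveI2[of _ _ 1])
  then have "norm (S x) / norm x \<le> dobrushin P S"
    using assms(2,3) False by (auto simp: dobrushin_def intro!: cSUP_upper)
  then show ?thesis
    using False by (simp add: field_simps)
qed

lemma dobrushin_nonneg:
  assumes "\<And>x. norm (S x) \<le> norm x" "P \<noteq> id" "P x = 0" "x \<noteq> 0"
  shows "0 \<le> dobrushin P S"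
proof -
  have "0 \<le> dobrushin P S * norm x"
    using norm_ge_zero norm_le_dobrushin[OF assms(1-3)] by (rule order_trans)
  then show ?thesis
    using \<open>x \<noteq> 0\<close> by (simp add: zero_le_mult_iff)
qed

text \<open>
  Following the chain from \<open>Ps k x\<close>, the point stays near the moving target \<open>Ps n x\<close>: the
  target is fixed by \<open>T n\<close>, so that the new error at each step is one increment of the
  projections, and the errors already made do not grow under contractions.
\<close>
lemma ndmc_tracks_projections:
  assumes bl: "\<And>n. n \<ge> 1 \<Longrightarrow> bounded_linear (T n)"
    and contr: "\<And>n x. n \<ge> 1 \<Longrightarrow> norm (T n x) \<le> norm x"
    and proj: "\<And>n. n \<ge> 1 \<Longrightarrow> bounded_linear (Ps n)"
    and fixed: "\<And>n x. n \<ge> 1 \<Longrightarrow> T n (Ps n x) = Ps n x"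
    and "1 \<le> k" "k \<le> n"
  shows "norm (ndmc T k n (Ps k x) - Ps n x)
           \<le> (\<Sum>j=k..<n. onorm (\<lambda>x. Ps (Suc j) x - Ps j x)) * norm x"
  using \<open>k \<le> n\<close>
proof (induction n rule: dec_induct)
  case base
  show ?case by simp
next
  case (step n)
  let ?e = "\<lambda>j. onorm (\<lambda>x. Ps (Suc j) x - Ps j x)"
  let ?y = "ndmc T k n (Ps k x)"
  have "1 \<le> n"
    using step.hyps \<open>1 \<le> k\<close> by simp
  have "ndmc T k (Suc n) (Ps k x) - Ps (Suc n) x
          = T (Suc n) (?y - Ps n x) + T (Suc n) (Ps n x - Ps (Suc n) x)"
    using step.hyps fixed[of "Suc n"] bl[of "Suc n"]
    by (simp add: linear_diff bounded_linear.linear)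
  also have "norm \<dots> \<le> norm (?y - Ps n x) + norm (Ps n x - Ps (Suc n) x)"
    by (intro norm_triangle_le add_mono contr) auto
  also have "norm (Ps n x - Ps (Suc n) x) \<le> ?e n * norm x"
    unfolding norm_minus_commute[of "Ps n x"]
    using \<open>1 \<le> n\<close> by (intro onorm bounded_linear_sub proj) auto
  finally show ?case
    using step by (simp add: algebra_simps)
qed

lemma ndmc_almost_fixes_limit:
  assumes bl: "\<And>n. n \<ge> 1 \<Longrightarrow> bounded_linear (T n)"
    and contr: "\<And>n x. n \<ge> 1 \<Longrightarrow> norm (T n x) \<le> norm x"
    and proj: "\<And>n. n \<ge> 1 \<Longrightarrow> bounded_linear (Ps n)"
    and fixed: "\<And>n x. n \<ge> 1 \<Longrightarrow> T n (Ps n x) = Ps n x"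
    and sum: "summable (\<lambda>n. onorm (\<lambda>x. Ps (Suc n) x - Ps n x))"
    and P: "bounded_linear P" and k: "1 \<le> k" "k \<le> n"
  shows "norm (ndmc T k n (P x) - P x)
           \<le> (onorm (\<lambda>x. Ps k x - P x)
               + (\<Sum>j. onorm (\<lambda>x. Ps (Suc (j + k)) x - Ps (j + k) x))
               + onorm (\<lambda>x. Ps n x - P x)) * norm x"
proof -
  let ?e = "\<lambda>j. onorm (\<lambda>x. Ps (Suc j) x - Ps j x)"
  let ?d = "\<lambda>j. onorm (\<lambda>x. Ps j x - P x)"
  have dist: "norm (Ps j x - P x) \<le> ?d j * norm x" if "1 \<le> j" for j
    using that by (intro onorm bounded_linear_sub proj P)
  have e_nonneg: "0 \<le> ?e (j + k)" for j
    using k by (intro onorm_pos_le bounded_linear_sub proj) auto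
  have "(\<Sum>j=k..<n. ?e j) = (\<Sum>j<n-k. ?e (j + k))"
    using k sum.shift_bounds_nat_ivl[of ?e 0 k "n - k"]
    by (simp add: atLeast0LessThan)
  also have "\<dots> \<le> (\<Sum>j. ?e (j + k))"
    using sum e_nonneg
    by (intro sum_le_suminf) (auto simp: summable_iff_shift[of ?e])
  finally have tail: "(\<Sum>j=k..<n. ?e j) \<le> (\<Sum>j. ?e (j + k))" .
  have "norm (ndmc T k n (Ps k x) - Ps n x) \<le> (\<Sum>j=k..<n. ?e j) * norm x"
    using k by (rule ndmc_tracks_projections[of T Ps, rotated 4]) (fact bl contr proj fixed)+
  also have "\<dots> \<le> (\<Sum>j. ?e (j + k)) * norm x"
    by (rule mult_right_mono[OF tail norm_ge_zero])
  finally have middle: "norm (ndmc T k n (Ps k x) - Ps n x) \<le> (\<Sum>j. ?e (j + k)) * norm x" .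
  have "linear (ndmc T k n)"
    using ndmc_bounded_linear[OF bl] by (rule bounded_linear.linear)
  then have "ndmc T k n (P x) - P x
               = ndmc T k n (P x - Ps k x) + (ndmc T k n (Ps k x) - Ps n x) + (Ps n x - P x)"
    by (simp add: linear_diff)
  also have "norm \<dots> \<le> norm (Ps k x - P x) + norm (ndmc T k n (Ps k x) - Ps n x)
                        + norm (Ps n x - P x)"
    using ndmc_norm_le[of T k n "P x - Ps k x", OF contr]
    by (intro norm_triangle_le add_mono) (auto simp: norm_minus_commute)
  also have "\<dots> \<le> ?d k * norm x + (\<Sum>j. ?e (j + k)) * norm x + ?d n * norm x"
    using k by (intro add_mono dist middle) auto
  finally show ?thesis
    by (simp add: algebra_simps)
qed

section \<open>Weak ergodicity implies uniform ergodicity\<close>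

text \<open>
  The time \<open>k\<close> at which the chain is split has to be fixed before \<open>n\<close> grows: the choice of
  \<open>k\<close> controls how far \<open>T\<^sup>k\<^sup>,\<^sup>n P\<close> is from \<open>P\<close> for all \<open>n\<close> at once, whereas weak ergodicity
  of the remaining piece holds without uniformity in \<open>k\<close>.
\<close>
lemma weakly_ergodic_imp_uniformly_ergodic:
  fixes T Ps :: "nat \<Rightarrow> 'a::real_normed_vector \<Rightarrow> 'a"
  assumes bl: "\<And>n. n \<ge> 1 \<Longrightarrow> bounded_linear (T n)"
    and contr: "\<And>n x. n \<ge> 1 \<Longrightarrow> norm (T n x) \<le> norm x"
    and proj: "\<And>n. n \<ge> 1 \<Longrightarrow> projection (Ps n)"
    and fixed: "\<And>n. n \<ge> 1 \<Longrightarrow> T n \<circ> Ps n = Ps n \<and> Ps n \<circ> T n = Ps n"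
    and ld: "left_decreasing Ps"
    and sum: "summable (\<lambda>n. onorm (\<lambda>x. Ps (Suc n) x - Ps n x))"
    and lim: "operator_norm_limit Ps P"
    and weak: "weakly_ergodic T P"
  shows "uniformly_ergodic T P"
  unfolding uniformly_ergodic_def
proof (intro allI LIMSEQ_I)
  fix m and r :: real
  assume "r > 0"
  let ?e = "\<lambda>j. onorm (\<lambda>x. Ps (Suc j) x - Ps j x)"
  let ?d = "\<lambda>j. onorm (\<lambda>x. Ps j x - P x)"
  let ?Q = "\<lambda>x. x - P x"
  have P: "bounded_linear P" and d: "?d \<longlonglongrightarrow> 0"
    using lim by (auto simp: operator_norm_limit_def)
  have Q: "bounded_linear ?Q"
    by (intro bounded_linear_sub bounded_linear_ident P)
  have Psb: "bounded_linear (Ps n)" if "n \<ge> 1" for n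
    using proj[OF that] by (simp add: projection_def)
  have TP: "T n (Ps n x) = Ps n x" and PT: "Ps n (T n x) = Ps n x" if "n \<ge> 1" for n x
    using fixed[OF that] by (metis comp_apply)+
  have absorb: "P (T n x) = P x" if "n \<ge> 1" for n x
    using limit_absorbs_projection[OF lim proj ld that] PT[OF that] by metis
  have "P \<noteq> id"
  proof
    \<comment> \<open>The convention that the coefficient is \<open>1\<close> for the identity excludes this case.\<close>
    assume "P = id"
    with weak have "(\<lambda>n::nat. 1::real) \<longlonglongrightarrow> 0"
      by (simp add: weakly_ergodic_def dobrushin_def)
    then show False
      by (simp add: LIMSEQ_const_iff)
  qed
  have kernel: "P (?Q z) = 0" for z
    using P limit_idempotent[OF lim proj ld]
    by (simp add: linear_diff bounded_linear.linear)
  \<comment> \<open>As \<open>P \<noteq> id\<close>, some \<open>z - P z\<close> is a nonzero vector in the kernel of \<open>P\<close>, so that the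
    supremum defining the coefficient is not over the empty set.\<close>
  obtain z where z: "?Q z \<noteq> 0"
    using \<open>P \<noteq> id\<close> by (metis eq_id_iff right_minus_eq)
  have dobrushin_ge_0: "0 \<le> dobrushin P (ndmc T k n)" for k n
    using contr by (intro dobrushin_nonneg[OF _ \<open>P \<noteq> id\<close> kernel z] ndmc_norm_le)
  \<comment> \<open>Splitting the chain at any intermediate time \<open>k\<close>.\<close>
  have bound: "onorm (\<lambda>x. ndmc T m n x - P x)
                 \<le> dobrushin P (ndmc T k n) * onorm ?Q + (?d k + (\<Sum>j. ?e (j + k)) + ?d n)"
    if "1 \<le> k" "m \<le> k" "k \<le> n" for k n
  proof (rule onorm_bound)
    have "0 \<le> (\<Sum>j. ?e (j + k))"
      using that sum
      by (intro suminf_nonneg onorm_pos_le bounded_linear_sub Psb)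
         (auto simp: summable_iff_shift[of ?e])
    then show "0 \<le> dobrushin P (ndmc T k n) * onorm ?Q + (?d k + (\<Sum>j. ?e (j + k)) + ?d n)"
      using that
      by (intro add_nonneg_nonneg mult_nonneg_nonneg dobrushin_ge_0 onorm_pos_le
            bounded_linear_sub Q P Psb) auto
  next
    fix x
    let ?y = "ndmc T m k x"
    have "linear (ndmc T k n)"
      using ndmc_bounded_linear[OF bl] by (rule bounded_linear.linear)
    moreover have Py: "P ?y = P x"
      using absorb by (rule ndmc_absorbed)
    ultimately have "ndmc T m n x - P x = ndmc T k n (?Q ?y) + (ndmc T k n (P x) - P x)"
      using that by (simp add: ndmc_split[of m k n] linear_diff)
    also have "norm \<dots> \<le> norm (ndmc T k n (?Q ?y)) + norm (ndmc T k n (P x) - P x)"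
      by (rule norm_triangle_ineq)
    also have "norm (ndmc T k n (?Q ?y)) \<le> dobrushin P (ndmc T k n) * norm (?Q ?y)"
      using contr by (intro norm_le_dobrushin ndmc_norm_le \<open>P \<noteq> id\<close> kernel)
    also have "\<dots> \<le> dobrushin P (ndmc T k n) * (onorm ?Q * norm x)"
    proof (rule mult_left_mono[OF _ dobrushin_ge_0])
      have "norm (?Q ?y) \<le> onorm ?Q * norm ?y"
        by (rule onorm[OF Q])
      also have "\<dots> \<le> onorm ?Q * norm x"
        using contr by (intro mult_left_mono onorm_pos_le Q ndmc_norm_le)
      finally show "norm (?Q ?y) \<le> onorm ?Q * norm x" .
    qed
    also have "norm (ndmc T k n (P x) - P x) \<le> (?d k + (\<Sum>j. ?e (j + k)) + ?d n) * norm x"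
      using that by (intro ndmc_almost_fixes_limit bl contr Psb TP sum P)
    finally show "norm (ndmc T m n x - P x)
        \<le> (dobrushin P (ndmc T k n) * onorm ?Q + (?d k + (\<Sum>j. ?e (j + k)) + ?d n)) * norm x"
      by (simp add: algebra_simps)
  qed
  have "(\<lambda>k. ?d k + (\<Sum>j. ?e (j + k))) \<longlonglongrightarrow> 0 + 0"
    using suminf_exist_split2[OF sum] d by (intro tendsto_add)
  then have "\<forall>\<^sub>F k in sequentially. ?d k + (\<Sum>j. ?e (j + k)) < r / 2"
    using \<open>r > 0\<close> by (intro order_tendstoD(2)[where y = 0]) auto
  then have "\<forall>\<^sub>F k in sequentially. 1 \<le> k \<and> m \<le> k \<and> ?d k + (\<Sum>j. ?e (j + k)) < r / 2"
    by (intro eventually_conj eventually_ge_at_top)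
  then obtain k where k: "1 \<le> k" "m \<le> k" "?d k + (\<Sum>j. ?e (j + k)) < r / 2"
    by (auto simp: eventually_sequentially)
  have "(\<lambda>n. dobrushin P (ndmc T k n) * onorm ?Q + ?d n) \<longlonglongrightarrow> 0 * onorm ?Q + 0"
    using weak d by (intro tendsto_intros) (auto simp: weakly_ergodic_def)
  then have "\<forall>\<^sub>F n in sequentially. dobrushin P (ndmc T k n) * onorm ?Q + ?d n < r / 2"
    using \<open>r > 0\<close> by (intro order_tendstoD(2)[where y = 0]) auto
  then have "\<forall>\<^sub>F n in sequentially. norm (onorm (\<lambda>x. ndmc T m n x - P x) - 0) < r"
    using eventually_ge_at_top[of k]
  proof eventually_elim
    case (elim n)
    have "0 \<le> onorm (\<lambda>x. ndmc T m n x - P x)"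
      by (intro onorm_pos_le bounded_linear_sub ndmc_bounded_linear bl P)
    with bound[OF k(1,2) elim(2)] elim(1) k(3) show ?case
      by simp
  qed
  then show "\<exists>no. \<forall>n\<ge>no. norm (onorm (\<lambda>x. ndmc T m n x - P x) - 0) < r"
    by (simp add: eventually_sequentially)
qed

theorem theorem4p3:
  fixes f :: "'a::{ordered_real_vector,banach} \<Rightarrow> real"
    and T Ps :: "nat \<Rightarrow> 'a \<Rightarrow> 'a"
  assumes "abstract_state_space f"
    and "\<And>n. n \<ge> 1 \<Longrightarrow> markov_operator f (T n)"
    and "\<And>n. n \<ge> 1 \<Longrightarrow> projection (Ps n)"
    and "\<And>n. n \<ge> 1 \<Longrightarrow> T n \<circ> Ps n = Ps n \<and> Ps n \<circ> T n = Ps n"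
    and "left_decreasing Ps"
    and "summable (\<lambda>n. onorm (\<lambda>x. Ps (Suc n) x - Ps n x))"
    and "(\<lambda>k. \<Sum>n. onorm (\<lambda>x. Ps (Suc (n + k)) x - Ps (n + k) x)) \<longlonglongrightarrow> 0"
  shows "(\<exists>P. operator_norm_limit Ps P) \<and>
         (\<forall>P. operator_norm_limit Ps P \<longrightarrow> weakly_ergodic T P \<longrightarrow> uniformly_ergodic T P)"
proof -
  have contr: "norm (T n x) \<le> norm x" if "n \<ge> 1" for n x
    using markov_operator_norm_le[OF assms(1) assms(2)[OF that]] .
  have bl: "bounded_linear (T n)" if "n \<ge> 1" for n
    using assms(2)[OF that] contr[OF that]
    by (intro bounded_linear_intro[where K = 1])
       (auto simp: markov_operator_def linear_add linear_scale)
  have "bounded_linear (Ps n)" if "n \<ge> 1" for n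
    using assms(3)[OF that] by (simp add: projection_def)
  then show ?thesis
    using operator_norm_limit_exists[OF _ assms(6)]
      weakly_ergodic_imp_uniformly_ergodic[OF bl contr assms(3-6)]
    by blast
qed

end
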